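(* Let $f:\mathbb{R}^d\to\mathbb{R}$ be $L$-smooth and $\mu$-strongly convex (with $\mu>0$), and let $\psi:\mathbb{R}^d\to\mathbb{R}\cup\{+\infty\}$ be proper, closed and convex. Let $x_\star$ be the unique minimizer of $f+\psi$ and $h_\star:=\nabla f(x_\star)$. Let $(x_t,h_t)_{t\ge0}$ be the iterates of the SProxSkip algorithm with stepsize $\gamma$, probability $p$, initial $x_0,h_0\in\mathbb{R}^d$ and stochastic gradients $g_t(x_t)$. Assume that for all $t\ge0$ $$\mathbb{E}[g_t(x_t)\mid x_t]=\nabla f(x_t),$$ and that there are constants $A\ge0$, $C\ge0$ such that for all $t\ge0$ $$\mathbb{E}\left[\|g_t(x_t)-\nabla f(x_\star)\|^2\mid x_t\right]\le 2A\,D_f(x_t,x_\star)+C .$$ Let $0<\gamma\le\frac1A$ and $0<p\le1$. Then, with $\Psi_t:=\|x_t-x_\star\|^2+\frac{\gamma^2}{p^2}\|h_t-h_\star\|^2$, for every $T\ge1$, $$\mathbb{E}[\Psi_T]\le(1-\zeta)^T\Psi_0+\frac{\gamma^2C}{\zeta},\qquad\text{where }\zeta:=\min\{\gamma\mu,p^2\}.$$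
   Context: $\|\cdot\|$ is the Euclidean norm. $f$ is $L$-smooth if it is differentiable with $L$-Lipschitz gradient. The Bregman divergence is $D_f(x,y):=f(x)-f(y)-\langle\nabla f(y),x-y\rangle$. For $\eta>0$, $\mathrm{prox}_{\eta\psi}(x):=\arg\min_{y\in\mathbb{R}^d}\left[\frac12\|y-x\|^2+\eta\psi(y)\right]$. Convention: $1/A=+\infty$ if $A=0$. SProxSkip algorithm (stepsize $\gamma>0$, probability $p\in(0,1]$, initial $x_0,h_0\in\mathbb{R}^d$). At each iteration $t=0,1,2,\dots$ a random vector $g_t(x_t)\in\mathbb{R}^d$ (stochastic gradient at $x_t$) is drawn, and a coin $\theta_t\in\{0,1\}$ with $\mathrm{Prob}(\theta_t=1)=p$ is flipped, independently of everything drawn before, including $g_t(x_t)$. Then: - $\hat x_{t+1}=x_t-\gamma(g_t(x_t)-h_t)$; - if $\theta_t=1$: $x_{t+1}=\mathrm{prox}_{\frac\gamma p\psi}\left(\hat x_{t+1}-\frac\gamma p h_t\right)$; if $\theta_t=0$: $x_{t+1}=\hat x_{t+1}$; - $h_{t+1}=h_t+\frac p\gamma(x_{t+1}-\hat x_{t+1})$. *)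

theory Defs
  imports "HOL-Probability.Probability"
begin

definition grad :: "('a::euclidean_space \<Rightarrow> real) \<Rightarrow> 'a \<Rightarrow> 'a" where
  "grad f x = (THE D. GDERIV f x :> D)"

definition L_smooth :: "real \<Rightarrow> ('a::euclidean_space \<Rightarrow> real) \<Rightarrow> bool" where
  "L_smooth L f \<longleftrightarrow> (\<forall>x. f differentiable (at x)) \<and> L-lipschitz_on UNIV (grad f)"

definition strongly_convex :: "real \<Rightarrow> ('a::euclidean_space \<Rightarrow> real) \<Rightarrow> bool" where
  "strongly_convex \<mu> f \<longleftrightarrow>
     (\<forall>x y u. 0 \<le> u \<and> u \<le> 1 \<longrightarrow>
        f (u *\<^sub>R x + (1 - u) *\<^sub>R y) \<le> u * f x + (1 - u) * f y - \<mu> / 2 * u * (1 - u) * (norm (x - y))\<^sup>2)"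

definition bregman :: "('a::euclidean_space \<Rightarrow> real) \<Rightarrow> 'a \<Rightarrow> 'a \<Rightarrow> real" where
  "bregman f x y = f x - f y - grad f y \<bullet> (x - y)"

(* Functions into the reals extended by +infinity are functions into ereal that never take the
   value -infinity. The library's epigraph and convex_on only cover real-valued functions. *)

definition ereal_epigraph :: "('a \<Rightarrow> ereal) \<Rightarrow> ('a \<times> real) set" where
  "ereal_epigraph \<psi> = {(x, r). \<psi> x \<le> ereal r}"

definition proper_closed_convex :: "('a::euclidean_space \<Rightarrow> ereal) \<Rightarrow> bool" where
  "proper_closed_convex \<psi> \<longleftrightarrow>
     (\<forall>x. \<psi> x \<noteq> -\<infinity>) \<and> (\<exists>x. \<psi> x \<noteq> \<infinity>) \<and>
     closed (ereal_epigraph \<psi>) \<and> convex (ereal_epigraph \<psi>)"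

definition prox :: "real \<Rightarrow> ('a::euclidean_space \<Rightarrow> ereal) \<Rightarrow> 'a \<Rightarrow> 'a" where
  "prox \<eta> \<psi> x = arg_min (\<lambda>y. ereal (1 / 2 * (norm (y - x))\<^sup>2) + ereal \<eta> * \<psi> y) (\<lambda>_. True)"

(* One iteration; v is the drawn value of the stochastic gradient at the current x,
   and the coin shows 1 iff b holds. *)
definition sproxskip_step ::
  "('a::euclidean_space \<Rightarrow> ereal) \<Rightarrow> real \<Rightarrow> real \<Rightarrow> 'a \<Rightarrow> bool \<Rightarrow> 'a \<times> 'a \<Rightarrow> 'a \<times> 'a" where
  "sproxskip_step \<psi> \<gamma> p v b = (\<lambda>(x, h).
     let xhat = x - \<gamma> *\<^sub>R (v - h);
         x' = (if b then prox (\<gamma> / p) \<psi> (xhat - (\<gamma> / p) *\<^sub>R h) else xhat)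
     in (x', h + (p / \<gamma>) *\<^sub>R (x' - xhat)))"

(* The iterates as a function of the drawn gradient values v and coins b. *)
primrec sproxskip ::
  "('a::euclidean_space \<Rightarrow> ereal) \<Rightarrow> real \<Rightarrow> real \<Rightarrow> 'a \<Rightarrow> 'a \<Rightarrow> (nat \<Rightarrow> 'a) \<Rightarrow> (nat \<Rightarrow> bool)
    \<Rightarrow> nat \<Rightarrow> 'a \<times> 'a" where
  "sproxskip \<psi> \<gamma> p x0 h0 v b 0 = (x0, h0)"
| "sproxskip \<psi> \<gamma> p x0 h0 v b (Suc t) =
     sproxskip_step \<psi> \<gamma> p (v t) (b t) (sproxskip \<psi> \<gamma> p x0 h0 v b t)"

definition sigma_of :: "'w measure \<Rightarrow> 'b measure \<Rightarrow> ('w \<Rightarrow> 'b) \<Rightarrow> 'w measure" where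
  "sigma_of M N X = vimage_algebra (space M) X N"

(* Conditional expectation of a random vector, coordinatewise: the library has it for real-valued
   functions only. As with real_cond_exp, the value is meaningful only for integrable X. *)
definition vec_cond_exp ::
  "'w measure \<Rightarrow> 'w measure \<Rightarrow> ('w \<Rightarrow> 'a::euclidean_space) \<Rightarrow> 'w \<Rightarrow> 'a" where
  "vec_cond_exp M F X \<omega> = (\<Sum>b\<in>Basis. real_cond_exp M F (\<lambda>\<omega>'. X \<omega>' \<bullet> b) \<omega> *\<^sub>R b)"

(* The coin at time t is independent of everything drawn before it: the stochastic gradients
   up to and including time t and the earlier coins. The library's indep_var requires both
   variables to have the same type, hence independence of the generated sigma-algebras. *)
definition coin_independent_of_past ::
  "'w measure \<Rightarrow> (nat \<Rightarrow> 'w \<Rightarrow> 'a::euclidean_space) \<Rightarrow> (nat \<Rightarrow> 'w \<Rightarrow> bool) \<Rightarrow> nat \<Rightarrow> bool" where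
  "coin_independent_of_past M g \<theta> t \<longleftrightarrow>
     prob_space.indep_set M
       (sets (sigma_of M (count_space UNIV) (\<theta> t)))
       (sets (sigma_of M (PiM {..t} (\<lambda>_. borel) \<Otimes>\<^sub>M PiM {..<t} (\<lambda>_. count_space UNIV))
          (\<lambda>\<omega>. (\<lambda>s\<in>{..t}. g s \<omega>, \<lambda>s\<in>{..<t}. \<theta> s \<omega>))))"

end

theory Submission
  imports Defs
begin

text \<open>Optimality of \<open>x\<^sub>\<star>\<close> says \<open>-h\<^sub>\<star> \<in> \<partial>\<psi>(x\<^sub>\<star>)\<close>, and after a proximal step \<open>-h\<^sub>t\<^sub>+\<^sub>1 \<in> \<partial>\<psi>(x\<^sub>t\<^sub>+\<^sub>1)\<close>, so monotonicity of
  \<open>\<partial>\<psi>\<close> bounds \<open>\<Psi>\<^sub>t\<^sub>+\<^sub>1\<close> by a quadratic in \<open>d = (x\<^sub>t - x\<^sub>\<star>) - \<gamma> (g\<^sub>t - h\<^sub>\<star>)\<close> and \<open>e = h\<^sub>t - h\<^sub>\<star>\<close>. When this bound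
  is averaged over the independent coin, the inner products \<open>\<langle>d, e\<rangle>\<close> cancel, leaving
  \<open>\<parallel>d\<parallel>\<^sup>2 + (1 - p\<^sup>2) \<gamma>\<^sup>2/p\<^sup>2 \<parallel>e\<parallel>\<^sup>2\<close>. That is why conditioning on \<open>x\<^sub>t\<close> alone suffices: the expectation
  of \<open>\<parallel>d\<parallel>\<^sup>2\<close> contracts by strong convexity, unbiasedness and the second moment bound, where
  \<open>\<gamma> A \<le> 1\<close> makes the coefficient of the Bregman divergence nonpositive.\<close>

section \<open>Gradients and the first-order form of strong convexity\<close>

text \<open>Since \<open>grad\<close> is a definite description, it is meaningful only once
  existence and uniqueness are known. The representing vector has the values of the derivative on
  \<open>Basis\<close> as coordinates, and inner products with all directions determine it.\<close>

lemma GDERIV_grad: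
  fixes f :: "'a::euclidean_space \<Rightarrow> real"
  assumes "f differentiable (at x)"
  shows "GDERIV f x :> grad f x"
proof -
  obtain f' where f': "(f has_derivative f') (at x)"
    using assms by (auto simp: differentiable_def)
  interpret f': bounded_linear f' using f' by (rule has_derivative_bounded_linear)
  have "f' h = h \<bullet> (\<Sum>b\<in>Basis. f' b *\<^sub>R b)" for h
  proof -
    have "f' h = f' (\<Sum>b\<in>Basis. (h \<bullet> b) *\<^sub>R b)" by (simp add: euclidean_representation)
    also have "\<dots> = (\<Sum>b\<in>Basis. (h \<bullet> b) * f' b)" by (simp add: f'.sum f'.scaleR)
    finally show ?thesis by (simp add: inner_sum_right mult.commute)
  qed
  hence "f' = (\<lambda>h. h \<bullet> (\<Sum>b\<in>Basis. f' b *\<^sub>R b))" by (rule ext)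
  hence ex: "GDERIV f x :> (\<Sum>b\<in>Basis. f' b *\<^sub>R b)"
    using f' by (simp add: gderiv_def)
  have "D = D'" if "GDERIV f x :> D" "GDERIV f x :> D'" for D D'
  proof -
    have "(\<lambda>h. h \<bullet> D) = (\<lambda>h. h \<bullet> D')"
      using that unfolding gderiv_def by (rule has_derivative_unique)
    thus ?thesis by (metis inner_commute vector_eq_rdot)
  qed
  with ex show ?thesis unfolding grad_def by (metis (no_types, lifting) theI)
qed

text \<open>Convexity arguments give an inequality at step \<open>u\<close> in (0, 1). After
  division by \<open>u\<close> this one-sided limit turns it into a statement about the
  gradient.\<close>

lemma GDERIV_directional:
  fixes f :: "'a::real_inner \<Rightarrow> real"
  assumes "GDERIV f x :> D"
  shows "((\<lambda>u. (f (x + u *\<^sub>R d) - f x) / u) \<longlongrightarrow> D \<bullet> d) (at_right 0)"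
proof -
  have "(f has_derivative (\<lambda>h. h \<bullet> D)) (at (x + 0 *\<^sub>R d))"
    using assms by (simp add: gderiv_def)
  hence "((\<lambda>u. f (x + u *\<^sub>R d)) has_derivative (\<lambda>u. (u *\<^sub>R d) \<bullet> D)) (at 0)"
    by (intro has_derivative_compose[where g = f and f = "\<lambda>u. x + u *\<^sub>R d"])
      (auto intro!: derivative_eq_intros)
  hence "((\<lambda>u. f (x + u *\<^sub>R d)) has_field_derivative (D \<bullet> d)) (at 0)"
    by (simp add: has_field_derivative_def inner_commute mult_commute_abs)
  hence "((\<lambda>u. (f (x + u *\<^sub>R d) - f x) / u) \<longlongrightarrow> D \<bullet> d) (at 0)"
    by (simp add: DERIV_def)
  thus ?thesis by (simp add: filterlim_at_split)
qed

lemma strongly_convex_gradient_inequality: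
  assumes sc: "strongly_convex \<mu> f" and D: "GDERIV f x :> D"
  shows "f x + D \<bullet> (y - x) + \<mu> / 2 * (norm (x - y))\<^sup>2 \<le> f y"
proof -
  have "(f (x + u *\<^sub>R (y - x)) - f x) / u \<le> f y - f x - \<mu> / 2 * (1 - u) * (norm (x - y))\<^sup>2"
    if u: "0 < u" "u < 1" for u
  proof -
    have "f (u *\<^sub>R y + (1 - u) *\<^sub>R x)
        \<le> u * f y + (1 - u) * f x - \<mu> / 2 * u * (1 - u) * (norm (y - x))\<^sup>2"
      using sc u unfolding strongly_convex_def by auto
    moreover have "u *\<^sub>R y + (1 - u) *\<^sub>R x = x + u *\<^sub>R (y - x)"
      by (simp add: algebra_simps)
    ultimately have "f (x + u *\<^sub>R (y - x)) - f x
        \<le> (f y - f x - \<mu> / 2 * (1 - u) * (norm (x - y))\<^sup>2) * u"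
      by (simp add: algebra_simps norm_minus_commute)
    thus ?thesis using u by (simp add: pos_divide_le_eq)
  qed
  hence "\<forall>\<^sub>F u in at_right 0. (f (x + u *\<^sub>R (y - x)) - f x) / u
      \<le> f y - f x - \<mu> / 2 * (1 - u) * (norm (x - y))\<^sup>2"
    by (auto simp: eventually_at_right_field intro!: exI[of _ 1])
  moreover have "((\<lambda>u. f y - f x - \<mu> / 2 * (1 - u) * (norm (x - y))\<^sup>2)
      \<longlongrightarrow> f y - f x - \<mu> / 2 * (1 - 0) * (norm (x - y))\<^sup>2) (at_right 0)"
    by (intro tendsto_intros)
  ultimately have "D \<bullet> (y - x) \<le> f y - f x - \<mu> / 2 * (1 - 0) * (norm (x - y))\<^sup>2"
    using GDERIV_directional[OF D] by (intro tendsto_le[OF _ _ GDERIV_directional[OF D]]) auto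
  thus ?thesis by simp
qed

section \<open>Subgradients of extended-valued functions and the proximal map\<close>

text \<open>Quantifying over real upper bounds \<open>q\<close> of \<open>\<psi> y\<close> keeps all
  arithmetic in the reals: a point with infinite value imposes no condition. Finiteness at
  \<open>x\<close> is built in.\<close>

definition ereal_subgradient :: "('a::real_inner \<Rightarrow> ereal) \<Rightarrow> 'a \<Rightarrow> 'a \<Rightarrow> bool" where
  "ereal_subgradient \<psi> x s \<longleftrightarrow>
     (\<exists>r. \<psi> x = ereal r \<and> (\<forall>y q. \<psi> y \<le> ereal q \<longrightarrow> r + s \<bullet> (y - x) \<le> q))"

lemma ereal_subgradient_monotone:
  assumes "ereal_subgradient \<psi> x s" "ereal_subgradient \<psi> y t"
  shows "(s - t) \<bullet> (x - y) \<ge> 0"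
proof -
  obtain r q where r: "\<psi> x = ereal r" and q: "\<psi> y = ereal q"
    and "r + s \<bullet> (y - x) \<le> q" "q + t \<bullet> (x - y) \<le> r"
    using assms unfolding ereal_subgradient_def by (metis order_refl)
  thus ?thesis by (simp add: inner_diff_left inner_diff_right)
qed

text \<open>Fermat's rule for a differentiable, possibly nonconvex \<phi> plus a convex \<psi>. It
  serves twice: with \<phi> = f for the optimality of \<open>xstar\<close>, and with half the
  squared distance for the proximal map.\<close>

lemma ereal_subgradient_of_arg_min:
  fixes \<psi> :: "'a::euclidean_space \<Rightarrow> ereal"
  assumes psi: "proper_closed_convex \<psi>" and \<eta>: "\<eta> > 0"
    and min: "is_arg_min (\<lambda>y. ereal (\<phi> y) + ereal \<eta> * \<psi> y) (\<lambda>_. True) x"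
    and D: "GDERIV \<phi> x :> D"
  shows "ereal_subgradient \<psi> x (- (1 / \<eta>) *\<^sub>R D)"
proof -
  have ninf: "\<psi> z \<noteq> -\<infinity>" for z using psi by (simp add: proper_closed_convex_def)
  have le: "ereal (\<phi> x) + ereal \<eta> * \<psi> x \<le> ereal (\<phi> z) + ereal \<eta> * \<psi> z" for z
    using min by (auto simp: is_arg_min_def not_less)
  obtain z where "\<psi> z \<noteq> \<infinity>" using psi by (auto simp: proper_closed_convex_def)
  with ninf obtain rz where rz: "\<psi> z = ereal rz" by (metis ereal_cases)
  have "\<psi> x \<noteq> \<infinity>" using le[of z] \<eta> by (auto simp: rz)
  with ninf obtain r where r: "\<psi> x = ereal r" by (metis ereal_cases)
  have "r + (- (1 / \<eta>) *\<^sub>R D) \<bullet> (y - x) \<le> q" if q: "\<psi> y \<le> ereal q" for y q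
  proof -
    \<comment> \<open>Moving the fraction \<open>u\<close> from \<open>x\<close> towards
      \<open>y\<close> raises \<psi> by at most \<open>u * (q - r)\<close>, by convexity of the
      epigraph. Minimality of \<open>x\<close> says that \<phi> cannot fall by more than \<eta>
      times this amount.\<close>
    have "- ((\<phi> (x + u *\<^sub>R (y - x)) - \<phi> x) / u) \<le> \<eta> * (q - r)" if u: "0 < u" "u < 1" for u
    proof -
      have "(x, r) \<in> ereal_epigraph \<psi>" "(y, q) \<in> ereal_epigraph \<psi>"
        using r q by (auto simp: ereal_epigraph_def)
      moreover have "convex (ereal_epigraph \<psi>)" using psi by (simp add: proper_closed_convex_def)
      ultimately have "(1 - u) *\<^sub>R (x, r) + u *\<^sub>R (y, q) \<in> ereal_epigraph \<psi>"
        using u by (intro convexD) auto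
      moreover have "(1 - u) *\<^sub>R (x, r) + u *\<^sub>R (y, q) = (x + u *\<^sub>R (y - x), r + u * (q - r))"
        by (simp add: algebra_simps)
      ultimately have *: "\<psi> (x + u *\<^sub>R (y - x)) \<le> ereal (r + u * (q - r))"
        by (simp add: ereal_epigraph_def)
      with ninf obtain k where k: "\<psi> (x + u *\<^sub>R (y - x)) = ereal k"
        by (metis ereal_cases ereal_infty_less_eq(1) PInfty_neq_ereal(1))
      have "\<phi> x + \<eta> * r \<le> \<phi> (x + u *\<^sub>R (y - x)) + \<eta> * k"
        using le[of "x + u *\<^sub>R (y - x)"] by (simp add: r k)
      also have "\<eta> * k \<le> \<eta> * (r + u * (q - r))" using * k \<eta> by simp
      finally have "- (\<phi> (x + u *\<^sub>R (y - x)) - \<phi> x) \<le> \<eta> * (q - r) * u"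
        by (simp add: algebra_simps)
      thus ?thesis using u by (simp add: field_simps)
    qed
    hence "\<forall>\<^sub>F u in at_right 0. - ((\<phi> (x + u *\<^sub>R (y - x)) - \<phi> x) / u) \<le> \<eta> * (q - r)"
      by (auto simp: eventually_at_right_field intro!: exI[of _ 1])
    hence "- (D \<bullet> (y - x)) \<le> \<eta> * (q - r)"
      by (intro tendsto_upperbound[OF tendsto_minus[OF GDERIV_directional[OF D]]]) auto
    thus ?thesis using \<eta> by (simp add: field_simps)
  qed
  thus ?thesis using r by (auto simp: ereal_subgradient_def)
qed

text \<open>Minimizing over a slice of the epigraph makes the objective continuous; the subgradient
  bounds the slice.\<close>
lemma is_arg_min_prox:
  fixes \<psi> :: "'a::euclidean_space \<Rightarrow> ereal"
  assumes psi: "proper_closed_convex \<psi>" and \<eta>: "\<eta> > 0" and sub: "ereal_subgradient \<psi> z s"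
  shows "is_arg_min (\<lambda>y. ereal (1 / 2 * (norm (y - x))\<^sup>2) + ereal \<eta> * \<psi> y) (\<lambda>_. True)
           (prox \<eta> \<psi> x)"
proof -
  have ninf: "\<psi> z \<noteq> -\<infinity>" for z using psi by (simp add: proper_closed_convex_def)
  obtain r where r: "\<psi> z = ereal r" and aff: "\<And>y q. \<psi> y \<le> ereal q \<Longrightarrow> r + s \<bullet> (y - z) \<le> q"
    using sub by (auto simp: ereal_subgradient_def)
  define \<Phi> where "\<Phi> = (\<lambda>(y, q). 1 / 2 * (norm (y - x))\<^sup>2 + \<eta> * q)"
  \<comment> \<open>With the level of a known epigraph point, the slice \<open>K\<close> is
    nonempty, and an epigraph point outside \<open>K\<close> has a larger objective than
    \<open>(z, r)\<close>.\<close>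
  define c where "c = \<Phi> (z, r)"
  define K where "K = ereal_epigraph \<psi> \<inter> {w. \<Phi> w \<le> c}"
  have cont: "continuous_on S \<Phi>" for S
    unfolding \<Phi>_def case_prod_unfold by (intro continuous_intros)
  have "closed K" unfolding K_def
    using psi cont by (intro closed_Int closed_Collect_le) (auto simp: proper_closed_convex_def)
  moreover have "bounded K"
  proof -
    \<comment> \<open>On \<open>K\<close> the affine minorant at \<open>z\<close> gives \<open>(norm
      (y - x))\<^sup>2 + 2 * \<eta> * (r + s \<bullet> (y - z)) \<le> 2 * c\<close>. Completing the
      square centres this at \<open>x - \<eta> *\<^sub>R s\<close> with squared radius
      \<open>R\<close>. The height \<open>q\<close> is then bounded below by the minorant and above
      by the level \<open>c\<close>.\<close>
    define R where "R = 2 * c - 2 * \<eta> * (r + s \<bullet> (x - z)) + \<eta>\<^sup>2 * (norm s)\<^sup>2"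
    define B where "B = norm (x - \<eta> *\<^sub>R s) + sqrt R"
    have "norm y \<le> B \<and> q \<in> {r - norm s * (B + norm z)..c / \<eta>}" if "(y, q) \<in> K" for y q
    proof -
      have 1: "r + s \<bullet> (y - z) \<le> q" and 2: "1 / 2 * (norm (y - x))\<^sup>2 + \<eta> * q \<le> c"
        using that aff by (auto simp: K_def ereal_epigraph_def \<Phi>_def)
      have "\<eta> * (r + s \<bullet> (y - z)) \<le> \<eta> * q" using 1 \<eta> by simp
      with 2 have "(norm (y - x))\<^sup>2 + 2 * \<eta> * (r + s \<bullet> (y - z)) \<le> 2 * c" by simp
      moreover have "(norm (y - (x - \<eta> *\<^sub>R s)))\<^sup>2
          = (norm (y - x))\<^sup>2 + 2 * \<eta> * (s \<bullet> (y - x)) + \<eta>\<^sup>2 * (norm s)\<^sup>2"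
        unfolding power2_norm_eq_inner
        by (simp add: inner_simps inner_commute power2_eq_square algebra_simps)
      ultimately have "(norm (y - (x - \<eta> *\<^sub>R s)))\<^sup>2 \<le> R"
        unfolding R_def by (simp add: inner_simps algebra_simps)
      hence "norm (y - (x - \<eta> *\<^sub>R s)) \<le> sqrt R" by (rule real_le_rsqrt)
      hence yB: "norm y \<le> B"
        unfolding B_def using norm_triangle_ineq[of "x - \<eta> *\<^sub>R s" "y - (x - \<eta> *\<^sub>R s)"] by simp
      have "- (s \<bullet> (y - z)) \<le> norm s * norm (y - z)"
        using Cauchy_Schwarz_ineq2[of s "y - z"] by linarith
      also have "\<dots> \<le> norm s * (B + norm z)"
        using yB norm_triangle_ineq4[of y z] by (intro mult_left_mono) auto
      finally have "r - norm s * (B + norm z) \<le> q" using 1 by linarith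
      moreover have "\<eta> * q \<le> c" using 2 zero_le_power2[of "norm (y - x)"] by linarith
      hence "q \<le> c / \<eta>" using \<eta> by (simp add: field_simps)
      ultimately show ?thesis using yB by simp
    qed
    hence "K \<subseteq> cball 0 B \<times> {r - norm s * (B + norm z)..c / \<eta>}"
      by (auto simp: mem_Times_iff)
    thus ?thesis by (rule bounded_subset[rotated]) (intro bounded_Times bounded_cball bounded_closed_interval)
  qed
  ultimately have "compact K" by (simp add: compact_eq_bounded_closed)
  moreover have zK: "(z, r) \<in> K" by (simp add: K_def c_def ereal_epigraph_def r)
  ultimately obtain w where w: "w \<in> K" "\<And>v. v \<in> K \<Longrightarrow> \<Phi> w \<le> \<Phi> v"
    using continuous_attains_inf[OF _ _ cont] by (metis empty_iff)
  obtain y q where yq: "w = (y, q)" by (cases w)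
  define F where "F = (\<lambda>y. ereal (1 / 2 * (norm (y - x))\<^sup>2) + ereal \<eta> * \<psi> y)"
  have "F y \<le> F y'" for y'
  proof -
    \<comment> \<open>The height \<open>q\<close> only has to dominate \<open>\<psi> y\<close>; as
      \<eta> is positive, this already gives \<open>F y \<le> \<Phi> w\<close>.\<close>
    have "\<psi> y \<le> ereal q" using w(1) yq by (simp add: K_def ereal_epigraph_def)
    hence "F y \<le> ereal (\<Phi> w)"
      using \<eta> ninf[of y] by (cases "\<psi> y") (auto simp: F_def \<Phi>_def yq)
    also have "ereal (\<Phi> w) \<le> F y'"
    proof (cases "\<psi> y'")
      case (real k)
      show ?thesis
      proof (cases "(y', k) \<in> K")
        case True
        thus ?thesis using w(2)[OF True] real by (simp add: F_def \<Phi>_def)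
      next
        case False
        hence "c < \<Phi> (y', k)" using real by (auto simp: K_def ereal_epigraph_def)
        with w(2)[OF zK] show ?thesis using real by (simp add: F_def c_def \<Phi>_def)
      qed
    next
      case PInf thus ?thesis using \<eta> by (simp add: F_def)
    next
      case MInf with ninf show ?thesis by simp
    qed
    finally show ?thesis .
  qed
  hence "is_arg_min F (\<lambda>_. True) y" by (auto simp: is_arg_min_def not_less)
  \<comment> \<open>\<open>prox\<close> is a choice among minimizers, so the existence of one
    minimizer makes the chosen point a minimizer.\<close>
  hence "is_arg_min F (\<lambda>_. True) (prox \<eta> \<psi> x)"
    unfolding prox_def arg_min_def F_def by (rule someI)
  thus ?thesis by (simp add: F_def)
qed

lemma prox_subgradient:
  fixes \<psi> :: "'a::euclidean_space \<Rightarrow> ereal"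
  assumes psi: "proper_closed_convex \<psi>" and \<eta>: "\<eta> > 0" and sub: "ereal_subgradient \<psi> z s"
  shows "ereal_subgradient \<psi> (prox \<eta> \<psi> x) ((1 / \<eta>) *\<^sub>R (x - prox \<eta> \<psi> x))"
proof -
  define y where "y = prox \<eta> \<psi> x"
  have "GDERIV (\<lambda>y. 1 / 2 * (norm (y - x))\<^sup>2) y :> (y - x)"
    unfolding gderiv_def power2_norm_eq_inner
    by (auto intro!: derivative_eq_intros simp: inner_commute fun_eq_iff)
  from ereal_subgradient_of_arg_min[OF psi \<eta> is_arg_min_prox[OF assms, of x, folded y_def] this]
  show ?thesis by (simp add: y_def scaleR_diff_right)
qed

text \<open>Monotonicity of the subdifferential, applied to the two proximal residuals, followed by
  Cauchy-Schwarz. The purpose is continuity, hence Borel measurability, of the proximal map: without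
  it the iterates would not be known to be random vectors.\<close>

lemma prox_nonexpansive:
  fixes \<psi> :: "'a::euclidean_space \<Rightarrow> ereal"
  assumes psi: "proper_closed_convex \<psi>" and \<eta>: "\<eta> > 0" and sub: "ereal_subgradient \<psi> z s"
  shows "1-lipschitz_on UNIV (prox \<eta> \<psi>)"
proof (rule lipschitz_onI)
  fix x y
  define a b where "a = prox \<eta> \<psi> x" and "b = prox \<eta> \<psi> y"
  have "((1 / \<eta>) *\<^sub>R (x - a) - (1 / \<eta>) *\<^sub>R (y - b)) \<bullet> (a - b) \<ge> 0"
    unfolding a_def b_def by (intro ereal_subgradient_monotone[where \<psi> = \<psi>] prox_subgradient[OF psi \<eta> sub])
  hence "(1 / \<eta>) * (((x - y) - (a - b)) \<bullet> (a - b)) \<ge> 0"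
    by (simp add: inner_simps algebra_simps)
  hence "((x - y) - (a - b)) \<bullet> (a - b) \<ge> 0" using \<eta> by (simp add: zero_le_divide_iff)
  hence "(norm (a - b))\<^sup>2 \<le> (x - y) \<bullet> (a - b)"
    by (simp add: inner_diff_left power2_norm_eq_inner)
  also have "\<dots> \<le> norm (x - y) * norm (a - b)" by (rule norm_cauchy_schwarz)
  finally have "norm (a - b) \<le> norm (x - y)"
    by (cases "norm (a - b) = 0") (auto simp: power2_eq_square)
  thus "dist (prox \<eta> \<psi> x) (prox \<eta> \<psi> y) \<le> 1 * dist x y"
    by (simp add: dist_norm a_def b_def)
qed simp

section \<open>One iteration for fixed draws, and its average over the coin\<close>

text \<open>If the coin shows 1, the vector on the right equals
  \<open>(x' - xs) - (\<gamma> / p) *\<^sub>R (h' - hs)\<close>. Its squared norm is the left side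
  minus a multiple of \<open>(h' - hs) \<bullet> (x' - xs)\<close>, which monotonicity makes
  nonpositive. If it shows 0, both sides agree.\<close>

lemma sproxskip_step_bound:
  fixes \<psi> :: "'a::euclidean_space \<Rightarrow> ereal"
  assumes psi: "proper_closed_convex \<psi>" and \<gamma>: "\<gamma> > 0" and p: "p > 0"
    and sub: "ereal_subgradient \<psi> xs (- hs)"
    and step: "(x', h') = sproxskip_step \<psi> \<gamma> p v b (x, h)"
    and d: "d = (x - xs) - \<gamma> *\<^sub>R (v - hs)" and e: "e = h - hs"
  shows "(norm (x' - xs))\<^sup>2 + \<gamma>\<^sup>2 / p\<^sup>2 * (norm (h' - hs))\<^sup>2
    \<le> (if b then (norm (d + (\<gamma> - \<gamma> / p) *\<^sub>R e))\<^sup>2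
        else (norm (d + \<gamma> *\<^sub>R e))\<^sup>2 + \<gamma>\<^sup>2 / p\<^sup>2 * (norm e)\<^sup>2)"
proof -
  define xh where "xh = x - \<gamma> *\<^sub>R (v - h)"
  have xh: "xh - xs = d + \<gamma> *\<^sub>R e" by (simp add: xh_def d e algebra_simps)
  show ?thesis
  proof (cases b)
    case True
    define y where "y = xh - (\<gamma> / p) *\<^sub>R h"
    have x': "x' = prox (\<gamma> / p) \<psi> y" and h': "h' = h + (p / \<gamma>) *\<^sub>R (x' - xh)"
      using step True by (simp_all add: sproxskip_step_def Let_def y_def xh_def)
    \<comment> \<open>The update of \<open>h\<close> makes \<open>- h'\<close> exactly the residual
      of the proximal step with parameter \<open>\<gamma> / p\<close>, hence a subgradient at
      \<open>x'\<close>.\<close>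
    have h'2: "h' = - ((p / \<gamma>) *\<^sub>R (y - x'))"
      using \<gamma> p by (simp add: h' y_def algebra_simps)
    have "ereal_subgradient \<psi> x' (- h')"
      using prox_subgradient[OF psi _ sub, of "\<gamma> / p" y] \<gamma> p by (simp add: x' h'2)
    from ereal_subgradient_monotone[OF this sub]
    have mono: "(h' - hs) \<bullet> (x' - xs) \<le> 0" by (simp add: inner_diff_left)
    have "d + (\<gamma> - \<gamma> / p) *\<^sub>R e = (x' - xs) - (\<gamma> / p) *\<^sub>R (h' - hs)"
    proof -
      have "(\<gamma> / p) *\<^sub>R h' = x' - y" using \<gamma> p by (simp add: h'2)
      hence "(x' - xs) - (\<gamma> / p) *\<^sub>R (h' - hs) = (xh - xs) - (\<gamma> / p) *\<^sub>R e"
        by (simp add: y_def e scaleR_diff_right)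
      thus ?thesis by (simp add: xh scaleR_diff_left)
    qed
    moreover have "(norm (a - (\<gamma> / p) *\<^sub>R b))\<^sup>2
        = (norm a)\<^sup>2 + \<gamma>\<^sup>2 / p\<^sup>2 * (norm b)\<^sup>2 - 2 * ((\<gamma> / p) * (b \<bullet> a))" for a b :: 'a
      unfolding power2_norm_eq_inner inner_simps inner_commute[of a b]
      by (simp add: power2_eq_square right_diff_distrib diff_divide_distrib)
    moreover have "(\<gamma> / p) * ((h' - hs) \<bullet> (x' - xs)) \<le> 0"
      using mono \<gamma> p by (intro mult_nonneg_nonpos) auto
    ultimately show ?thesis using True by (smt (verit))
  next
    case False
    hence "x' = xh" "h' = h"
      using step by (simp_all add: sproxskip_step_def Let_def xh_def)
    thus ?thesis using False by (simp add: xh e)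
  qed
qed

text \<open>The coefficient of \<open>d \<bullet> e\<close> is \<open>2 * p * (\<gamma> - \<gamma> /
  p) + 2 * (1 - p) * \<gamma> = 0\<close>. In units of \<open>\<gamma>\<^sup>2 / p\<^sup>2\<close>,
  that of the squared norm of \<open>e\<close> is \<open>p * (1 - p)\<^sup>2 + (1 - p) * (1 +
  p\<^sup>2) = 1 - p\<^sup>2\<close>.\<close>

lemma coin_average_identity:
  fixes d e :: "'a::real_inner"
  assumes "p \<noteq> 0"
  shows "p * (norm (d + (\<gamma> - \<gamma> / p) *\<^sub>R e))\<^sup>2
      + (1 - p) * ((norm (d + \<gamma> *\<^sub>R e))\<^sup>2 + \<gamma>\<^sup>2 / p\<^sup>2 * (norm e)\<^sup>2)
    = (norm d)\<^sup>2 + (1 - p\<^sup>2) * (\<gamma>\<^sup>2 / p\<^sup>2 * (norm e)\<^sup>2)"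
proof -
  define c where "c = \<gamma> / p"
  have \<gamma>: "\<gamma> = c * p" using assms by (simp add: c_def)
  have "\<gamma>\<^sup>2 / p\<^sup>2 = c\<^sup>2" by (simp add: c_def power_divide)
  thus ?thesis
    unfolding c_def[symmetric] unfolding \<gamma> power2_norm_eq_inner inner_simps inner_commute[of e d]
    by (simp add: algebra_simps power2_eq_square)
qed

section \<open>Square-integrable random vectors\<close>

definition square_integrable :: "'w measure \<Rightarrow> ('w \<Rightarrow> 'a::euclidean_space) \<Rightarrow> bool" where
  "square_integrable M X \<longleftrightarrow> X \<in> borel_measurable M \<and> integrable M (\<lambda>\<omega>. (norm (X \<omega>))\<^sup>2)"

lemma square_integrable_measurable: "square_integrable M X \<Longrightarrow> X \<in> borel_measurable M"
  and square_integrable_norm2: "square_integrable M X \<Longrightarrow> integrable M (\<lambda>\<omega>. (norm (X \<omega>))\<^sup>2)"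
  by (simp_all add: square_integrable_def)

lemma square_integrable_bound:
  assumes "X \<in> borel_measurable M" "integrable M Y" "AE \<omega> in M. (norm (X \<omega>))\<^sup>2 \<le> Y \<omega>"
  shows "square_integrable M X"
  unfolding square_integrable_def
proof
  have [measurable]: "X \<in> borel_measurable M" by fact
  show "integrable M (\<lambda>\<omega>. (norm (X \<omega>))\<^sup>2)"
    using assms(3) by (intro Bochner_Integration.integrable_bound[OF assms(2)]) auto
qed fact

lemma square_integrable_add:
  assumes "square_integrable M X" "square_integrable M Y"
  shows "square_integrable M (\<lambda>\<omega>. X \<omega> + Y \<omega>)"
proof (rule square_integrable_bound)
  show "(\<lambda>\<omega>. X \<omega> + Y \<omega>) \<in> borel_measurable M"
    using assms by (auto simp: square_integrable_def)
  show "integrable M (\<lambda>\<omega>. 2 * (norm (X \<omega>))\<^sup>2 + 2 * (norm (Y \<omega>))\<^sup>2)"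
    using assms by (auto simp: square_integrable_def)
  have "(norm (a + b))\<^sup>2 \<le> 2 * (norm a)\<^sup>2 + 2 * (norm b)\<^sup>2" for a b :: 'b
  proof -
    have "(norm (a + b))\<^sup>2 + (norm (a - b))\<^sup>2 = 2 * (norm a)\<^sup>2 + 2 * (norm b)\<^sup>2"
      unfolding power2_norm_eq_inner by (simp add: inner_simps)
    thus ?thesis using zero_le_power2[of "norm (a - b)"] by linarith
  qed
  thus "AE \<omega> in M. (norm (X \<omega> + Y \<omega>))\<^sup>2 \<le> 2 * (norm (X \<omega>))\<^sup>2 + 2 * (norm (Y \<omega>))\<^sup>2"
    by simp
qed

lemma square_integrable_scaleR:
  "square_integrable M X \<Longrightarrow> square_integrable M (\<lambda>\<omega>. c *\<^sub>R X \<omega>)"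
  by (auto simp: square_integrable_def power_mult_distrib)

lemma square_integrable_diff:
  assumes "square_integrable M X" "square_integrable M Y"
  shows "square_integrable M (\<lambda>\<omega>. X \<omega> - Y \<omega>)"
  using square_integrable_add[OF assms(1) square_integrable_scaleR[OF assms(2), of "-1"]] by simp

lemma (in finite_measure) square_integrable_const: "square_integrable M (\<lambda>_. c)"
  by (simp add: square_integrable_def)

lemma square_integrable_diff_const_iff:
  assumes "finite_measure M"
  shows "square_integrable M (\<lambda>\<omega>. X \<omega> - c) \<longleftrightarrow> square_integrable M X"
proof
  assume "square_integrable M (\<lambda>\<omega>. X \<omega> - c)"
  from square_integrable_add[OF this finite_measure.square_integrable_const[OF assms, of c]]
  show "square_integrable M X" by simp
qed (intro square_integrable_diff finite_measure.square_integrable_const assms)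

lemma square_integrable_inner:
  assumes "square_integrable M X" "square_integrable M Y"
  shows "integrable M (\<lambda>\<omega>. X \<omega> \<bullet> Y \<omega>)"
proof (rule Bochner_Integration.integrable_bound)
  show "integrable M (\<lambda>\<omega>. (norm (X \<omega>))\<^sup>2 + (norm (Y \<omega>))\<^sup>2)"
    using assms by (auto simp: square_integrable_def)
  show "(\<lambda>\<omega>. X \<omega> \<bullet> Y \<omega>) \<in> borel_measurable M"
    using assms by (auto simp: square_integrable_def)
  have "\<bar>a \<bullet> b\<bar> \<le> (norm a)\<^sup>2 + (norm b)\<^sup>2" for a b :: 'b
  proof -
    have "\<bar>a \<bullet> b\<bar> \<le> norm a * norm b" by (rule Cauchy_Schwarz_ineq2)
    moreover have "2 * (norm a * norm b) \<le> (norm a)\<^sup>2 + (norm b)\<^sup>2"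
      using sum_squares_bound[of "norm a" "norm b"] by (simp add: mult.assoc)
    moreover have "0 \<le> norm a * norm b" by simp
    ultimately show ?thesis by linarith
  qed
  thus "AE \<omega> in M. norm (X \<omega> \<bullet> Y \<omega>) \<le> norm ((norm (X \<omega>))\<^sup>2 + (norm (Y \<omega>))\<^sup>2)" by simp
qed

lemma square_integrable_inner_const:
  assumes "square_integrable M X"
  shows "square_integrable M (\<lambda>\<omega>. X \<omega> \<bullet> c)"
proof (rule square_integrable_bound)
  show "integrable M (\<lambda>\<omega>. (norm (X \<omega>))\<^sup>2 * (norm c)\<^sup>2)"
    using assms by (auto simp: square_integrable_def)
  show "(\<lambda>\<omega>. X \<omega> \<bullet> c) \<in> borel_measurable M"
    using assms by (auto simp: square_integrable_def)
  have "(norm (a \<bullet> c))\<^sup>2 \<le> (norm a)\<^sup>2 * (norm c)\<^sup>2" for a :: 'b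
    unfolding power_mult_distrib[symmetric]
    by (intro power_mono) (auto simp: Cauchy_Schwarz_ineq2)
  thus "AE \<omega> in M. (norm (X \<omega> \<bullet> c))\<^sup>2 \<le> (norm (X \<omega>))\<^sup>2 * (norm c)\<^sup>2" by simp
qed

section \<open>Generated sigma-algebras, independence and conditional expectation\<close>

lemma space_sigma_of [simp]: "space (sigma_of M N X) = space M"
  by (simp add: sigma_of_def)

lemma measurable_sigma_of: "X \<in> measurable M N \<Longrightarrow> X \<in> measurable (sigma_of M N X) N"
  unfolding sigma_of_def by (rule measurable_vimage_algebra1) (auto simp: measurable_def)

lemma subalgebra_sigma_of:
  assumes "X \<in> measurable M N"
  shows "subalgebra M (sigma_of M N X)"
  using assms by (auto simp: subalgebra_def sigma_of_def sets_vimage_algebra2 measurable_def)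

lemma (in prob_space) prob_space_sigma_finite_subalgebra:
  "subalgebra M F \<Longrightarrow> sigma_finite_subalgebra M F"
  by (intro finite_measure_subalgebra_is_sigma_finite
      finite_measure_subalgebra.intro finite_measure_subalgebra_axioms.intro finite_measure_axioms)

text \<open>The coin selects between two variables of the past. Written as
  \<open>Y0 + I * (Y1 - Y0)\<close> with \<open>I\<close> the indicator of the coin, the selection
  contains one product of independent factors, whose expectation splits.\<close>

lemma (in prob_space) expectation_if_indep:
  fixes Y1 Y0 :: "'a \<Rightarrow> real"
  assumes F: "subalgebra M F" and B: "B \<in> measurable M (count_space UNIV)"
    and indep: "indep_set (sets (sigma_of M (count_space UNIV) B)) (sets F)"
    and Y1: "Y1 \<in> borel_measurable F" "integrable M Y1"
    and Y0: "Y0 \<in> borel_measurable F" "integrable M Y0"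
  shows "integrable M (\<lambda>\<omega>. if B \<omega> then Y1 \<omega> else Y0 \<omega>)"
    and "expectation (\<lambda>\<omega>. if B \<omega> then Y1 \<omega> else Y0 \<omega>)
      = prob {\<omega> \<in> space M. B \<omega>} * expectation Y1 + (1 - prob {\<omega> \<in> space M. B \<omega>}) * expectation Y0"
proof -
  define I :: "'a \<Rightarrow> real" where "I = (\<lambda>\<omega>. of_bool (B \<omega>))"
  define Y where "Y = (\<lambda>\<omega>. Y1 \<omega> - Y0 \<omega>)"
  have [measurable]: "B \<in> measurable M (count_space UNIV)" by fact
  let ?S = "sigma_of M (count_space UNIV) B"
  have spF: "space F = space M" using F by (simp add: subalgebra_def)
  have BS [measurable]: "B \<in> measurable ?S (count_space UNIV)" by (rule measurable_sigma_of[OF B])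
  have IS: "I \<in> borel_measurable ?S" unfolding I_def by measurable
  have IM [measurable]: "I \<in> borel_measurable M" unfolding I_def by measurable
  have YF: "Y \<in> borel_measurable F" unfolding Y_def using Y1 Y0 by measurable
  have Yint: "integrable M Y" unfolding Y_def using Y1 Y0 by simp
  have Iint: "integrable M I"
    by (rule integrable_const_bound[of _ 1]) (auto simp: I_def)
  have "indep_set (sigma_sets (space M) {I -` A \<inter> space M | A. A \<in> sets borel})
      (sigma_sets (space M) {Y -` A \<inter> space M | A. A \<in> sets borel})"
  proof -
    \<comment> \<open>The sigma-algebras generated by \<open>I\<close> and \<open>Y\<close> lie
      inside those of the coin and of the past, and independence passes to smaller families.\<close>
    have 1: "sigma_sets (space M) {I -` A \<inter> space M | A. A \<in> sets borel} \<subseteq> sets ?S"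
      using sets.sigma_sets_subset[of "{I -` A \<inter> space M | A. A \<in> sets borel}" ?S]
        measurable_sets[OF IS] by auto
    have 2: "sigma_sets (space M) {Y -` A \<inter> space M | A. A \<in> sets borel} \<subseteq> sets F"
      using sets.sigma_sets_subset[of "{Y -` A \<inter> space M | A. A \<in> sets borel}" F]
        measurable_sets[OF YF] spF by auto
    show ?thesis
      using indep unfolding indep_set_def
      by (rule indep_sets_mono_sets) (use 1 2 in \<open>auto split: bool.split\<close>)
  qed
  hence iv: "indep_var borel I borel Y"
    using measurable_from_subalg[OF F YF] by (simp add: indep_var_eq)
  have eq: "(if B \<omega> then Y1 \<omega> else Y0 \<omega>) = Y0 \<omega> + I \<omega> * Y \<omega>" for \<omega>
    by (simp add: I_def Y_def)
  note int = indep_var_integrable[OF iv Iint Yint]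
  show "integrable M (\<lambda>\<omega>. if B \<omega> then Y1 \<omega> else Y0 \<omega>)"
    unfolding eq using int Y0 by simp
  have "expectation I = prob {\<omega> \<in> space M. B \<omega>}"
  proof -
    have "expectation I = expectation (indicator {\<omega> \<in> space M. B \<omega>})"
      by (intro Bochner_Integration.integral_cong) (auto simp: I_def)
    thus ?thesis by simp
  qed
  moreover have "expectation Y = expectation Y1 - expectation Y0"
    unfolding Y_def using Y1 Y0 by simp
  moreover have "expectation (\<lambda>\<omega>. if B \<omega> then Y1 \<omega> else Y0 \<omega>)
      = expectation Y0 + expectation I * expectation Y"
    unfolding eq using int Y0 indep_var_lebesgue_integral[OF iv Iint Yint] by simp
  ultimately show "expectation (\<lambda>\<omega>. if B \<omega> then Y1 \<omega> else Y0 \<omega>)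
      = prob {\<omega> \<in> space M. B \<omega>} * expectation Y1 + (1 - prob {\<omega> \<in> space M. B \<omega>}) * expectation Y0"
    by (simp only:) (simp add: algebra_simps)
qed

text \<open>An \<open>F\<close>-measurable factor can be pulled out in each coordinate; square
  integrability of both vectors makes every coordinate product integrable, as this requires.\<close>

lemma (in prob_space) expectation_inner_vec_cond_exp:
  fixes Z G :: "'a \<Rightarrow> 'b::euclidean_space"
  assumes F: "subalgebra M F" and ZF: "Z \<in> borel_measurable F"
    and Z: "square_integrable M Z" and G: "square_integrable M G"
  shows "integrable M (\<lambda>\<omega>. Z \<omega> \<bullet> vec_cond_exp M F G \<omega>)"
    and "expectation (\<lambda>\<omega>. Z \<omega> \<bullet> vec_cond_exp M F G \<omega>) = expectation (\<lambda>\<omega>. Z \<omega> \<bullet> G \<omega>)"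
proof -
  interpret sigma_finite_subalgebra M F by (rule prob_space_sigma_finite_subalgebra[OF F])
  have GM: "G \<in> borel_measurable M" by (rule square_integrable_measurable[OF G])
  have int: "integrable M (\<lambda>\<omega>. (Z \<omega> \<bullet> b) * (G \<omega> \<bullet> b))" for b
    using square_integrable_inner[OF square_integrable_inner_const[OF Z, of b]
        square_integrable_inner_const[OF G, of b]] by simp
  have "(\<lambda>\<omega>. Z \<omega> \<bullet> b) \<in> borel_measurable F" "(\<lambda>\<omega>. G \<omega> \<bullet> b) \<in> borel_measurable M" for b
    using ZF GM by auto
  note ce = real_cond_exp_intg[OF int this]
  have 1: "Z \<omega> \<bullet> vec_cond_exp M F G \<omega>
      = (\<Sum>b\<in>Basis. (Z \<omega> \<bullet> b) * real_cond_exp M F (\<lambda>\<omega>. G \<omega> \<bullet> b) \<omega>)" for \<omega>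
    by (simp add: vec_cond_exp_def inner_sum_right mult.commute)
  have 2: "Z \<omega> \<bullet> G \<omega> = (\<Sum>b\<in>Basis. (Z \<omega> \<bullet> b) * (G \<omega> \<bullet> b))" for \<omega>
    by (rule euclidean_inner)
  show "integrable M (\<lambda>\<omega>. Z \<omega> \<bullet> vec_cond_exp M F G \<omega>)"
    unfolding 1 using ce by simp
  show "expectation (\<lambda>\<omega>. Z \<omega> \<bullet> vec_cond_exp M F G \<omega>) = expectation (\<lambda>\<omega>. Z \<omega> \<bullet> G \<omega>)"
    unfolding 1 2 using ce int by simp
qed

section \<open>Measurability of the iterates\<close>

text \<open>The measure \<open>N\<close> is left general because the result is applied both to the
  whole space and to the sigma-algebra of the past. The iterate \<open>t\<close> uses only draws
  with index below \<open>t\<close>.\<close>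

lemma measurable_sproxskip:
  fixes g :: "nat \<Rightarrow> 'w \<Rightarrow> 'a::euclidean_space"
  assumes [measurable]: "prox (\<gamma> / p) \<psi> \<in> borel_measurable borel"
    and "\<And>s. s < t \<Longrightarrow> g s \<in> borel_measurable N"
    and "\<And>s. s < t \<Longrightarrow> \<theta> s \<in> measurable N (count_space UNIV)"
  shows "(\<lambda>\<omega>. fst (sproxskip \<psi> \<gamma> p x0 h0 (\<lambda>s. g s \<omega>) (\<lambda>s. \<theta> s \<omega>) t)) \<in> borel_measurable N
    \<and> (\<lambda>\<omega>. snd (sproxskip \<psi> \<gamma> p x0 h0 (\<lambda>s. g s \<omega>) (\<lambda>s. \<theta> s \<omega>) t)) \<in> borel_measurable N"
  using assms(2,3)
proof (induction t)
  case 0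
  show ?case by simp
next
  case (Suc t)
  let ?z = "\<lambda>\<omega>. sproxskip \<psi> \<gamma> p x0 h0 (\<lambda>s. g s \<omega>) (\<lambda>s. \<theta> s \<omega>) t"
  have [measurable]: "(\<lambda>\<omega>. fst (?z \<omega>)) \<in> borel_measurable N" "(\<lambda>\<omega>. snd (?z \<omega>)) \<in> borel_measurable N"
    using Suc by auto
  have [measurable]: "g t \<in> borel_measurable N" "\<theta> t \<in> measurable N (count_space UNIV)"
    using Suc.prems by auto
  show ?case
    unfolding sproxskip.simps sproxskip_step_def case_prod_unfold Let_def fst_conv snd_conv
    by (intro conjI; measurable)
qed

section \<open>Expected contraction of the gradient step\<close>

text \<open>In the expanded square, the cross term contributes at most -2\<gamma> times the expected
  divergence minus \<gamma>\<mu> times the expected squared distance. The second moment adds at most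
  \<open>\<gamma>\<^sup>2 * (2 * A)\<close> times the expected divergence plus
  \<open>\<gamma>\<^sup>2 * C\<close>. The divergence is left with the factor
  \<open>- 2 * \<gamma> * (1 - \<gamma> * A)\<close>. Square integrability of \<open>G\<close> is a
  conclusion and has to come before unbiasedness is exploited.\<close>

lemma expected_gradient_step:
  fixes f :: "'a::euclidean_space \<Rightarrow> real" and X G :: "'w \<Rightarrow> 'a"
  assumes M: "prob_space M"
    and smooth: "L_smooth L f" and strong: "strongly_convex \<mu> f" and mu_pos: "\<mu> > 0"
    and hs: "hs = grad f xs"
    and X: "square_integrable M X" and G: "G \<in> borel_measurable M"
    and unbiased: "AE \<omega> in M. vec_cond_exp M (sigma_of M borel X) G \<omega> = grad f (X \<omega>)"
    and A: "A \<ge> 0" and C: "C \<ge> 0"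
    and second_moment: "AE \<omega> in M.
          nn_cond_exp M (sigma_of M borel X) (\<lambda>\<omega>'. ennreal ((norm (G \<omega>' - hs))\<^sup>2)) \<omega>
            \<le> ennreal (2 * A * bregman f (X \<omega>) xs + C)"
    and \<gamma>: "\<gamma> > 0" "\<gamma> * A \<le> 1"
  shows "square_integrable M G"
    and "integral\<^sup>L M (\<lambda>\<omega>. (norm ((X \<omega> - xs) - \<gamma> *\<^sub>R (G \<omega> - hs)))\<^sup>2)
      \<le> (1 - \<gamma> * \<mu>) * integral\<^sup>L M (\<lambda>\<omega>. (norm (X \<omega> - xs))\<^sup>2) + \<gamma>\<^sup>2 * C"
proof -
  interpret prob_space M by fact
  let ?F = "sigma_of M borel X"
  have XM [measurable]: "X \<in> borel_measurable M" using X by (rule square_integrable_measurable)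
  have F: "subalgebra M ?F" by (rule subalgebra_sigma_of[OF XM])
  have XF: "X \<in> borel_measurable ?F" by (rule measurable_sigma_of[OF XM])
  interpret sub: sigma_finite_subalgebra M ?F by (rule prob_space_sigma_finite_subalgebra[OF F])
  have [measurable]: "G \<in> borel_measurable M" by fact
  have gd: "GDERIV f x :> grad f x" for x
    using smooth by (intro GDERIV_grad) (auto simp: L_smooth_def)
  have lip: "L-lipschitz_on UNIV (grad f)" using smooth by (simp add: L_smooth_def)
  have [measurable]: "grad f \<in> borel_measurable borel"
    using lipschitz_on_continuous_on[OF lip] by (rule borel_measurable_continuous_onI)
  have "continuous_on UNIV f"
    using smooth by (auto simp: L_smooth_def intro!: continuous_at_imp_continuous_on
        differentiable_imp_continuous_within)
  hence [measurable]: "f \<in> borel_measurable borel" by (rule borel_measurable_continuous_onI)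
  let ?D = "\<lambda>x. bregman f x xs"
  have sc: "bregman f x y \<ge> \<mu> / 2 * (norm (x - y))\<^sup>2" for x y
    using strongly_convex_gradient_inequality[OF strong gd, of y x]
    by (simp add: bregman_def norm_minus_commute)
  have D0: "?D x \<ge> 0" for x
    by (rule order_trans[OF _ sc]) (use mu_pos in simp)
  have three: "(x - xs) \<bullet> (grad f x - hs) = ?D x + bregman f xs x" for x
    by (simp add: bregman_def hs inner_simps inner_commute)
  \<comment> \<open>Of the two divergences in the symmetric sum, only \<open>bregman f xs x\<close>
    is replaced by its strong convexity bound; \<open>?D x\<close> is kept to absorb the second
    moment.\<close>
  have lower: "?D x + \<mu> / 2 * (norm (x - xs))\<^sup>2 \<le> (x - xs) \<bullet> (grad f x - hs)" for x
    using sc[of xs x] unfolding three by (simp add: norm_minus_commute)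
  \<comment> \<open>A crude constant suffices: the bound serves only to make the divergence
    integrable.\<close>
  have upper: "?D x \<le> L * (norm (x - xs))\<^sup>2" for x
  proof -
    have "0 \<le> \<mu> / 2 * (norm (x - xs))\<^sup>2" using mu_pos by simp
    hence "?D x \<le> (x - xs) \<bullet> (grad f x - hs)" using lower[of x] by linarith
    also have "\<dots> \<le> norm (x - xs) * norm (grad f x - hs)" by (rule norm_cauchy_schwarz)
    also have "\<dots> \<le> norm (x - xs) * (L * norm (x - xs))"
      using lipschitz_onD[OF lip, of x xs] by (intro mult_left_mono) (auto simp: dist_norm hs)
    finally show ?thesis by (simp add: power2_eq_square mult_ac)
  qed
  let ?Z = "\<lambda>\<omega>. X \<omega> - xs"
  have Z: "square_integrable M ?Z"
    using X by (simp add: square_integrable_diff_const_iff finite_measure_axioms)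
  have DM: "(\<lambda>\<omega>. ?D (X \<omega>)) \<in> borel_measurable M" unfolding bregman_def by measurable
  have Dint: "integrable M (\<lambda>\<omega>. ?D (X \<omega>))"
    by (rule Bochner_Integration.integrable_bound[OF integrable_mult_right[OF square_integrable_norm2[OF Z], of L] DM])
      (use D0 upper in \<open>auto intro!: always_eventually order_trans[OF _ abs_ge_self]\<close>)
  let ?N = "\<lambda>\<omega>. (norm (G \<omega> - hs))\<^sup>2"
  \<comment> \<open>The tower property is used for nonnegative integrals, where it holds before
    anything is known to be finite; finiteness of the bound then yields integrability of
    \<open>?N\<close>.\<close>
  have "(\<integral>\<^sup>+ \<omega>. ennreal (?N \<omega>) \<partial>M)
      = (\<integral>\<^sup>+ \<omega>. nn_cond_exp M ?F (\<lambda>\<omega>'. ennreal (?N \<omega>')) \<omega> \<partial>M)"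
    using sub.nn_cond_exp_intg[of "\<lambda>_. 1" "\<lambda>\<omega>. ennreal (?N \<omega>)"] by simp
  also have "\<dots> \<le> (\<integral>\<^sup>+ \<omega>. ennreal (2 * A * ?D (X \<omega>) + C) \<partial>M)"
    using second_moment by (rule nn_integral_mono_AE)
  also have "\<dots> = ennreal (expectation (\<lambda>\<omega>. 2 * A * ?D (X \<omega>) + C))"
    using Dint D0 A C by (intro nn_integral_eq_integral) auto
  also have "expectation (\<lambda>\<omega>. 2 * A * ?D (X \<omega>) + C) = 2 * A * expectation (\<lambda>\<omega>. ?D (X \<omega>)) + C"
    using Dint by (simp add: prob_space)
  finally have nn: "(\<integral>\<^sup>+ \<omega>. ennreal (?N \<omega>) \<partial>M) \<le> ennreal (2 * A * expectation (\<lambda>\<omega>. ?D (X \<omega>)) + C)" .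
  have Nint: "integrable M ?N"
    by (rule integrableI_bounded) (use nn in \<open>auto simp: order_le_less_trans[OF _ ennreal_less_top]\<close>)
  have ED: "expectation (\<lambda>\<omega>. ?D (X \<omega>)) \<ge> 0" using D0 by simp
  have EN: "expectation ?N \<le> 2 * A * expectation (\<lambda>\<omega>. ?D (X \<omega>)) + C"
  proof -
    have "2 * A * expectation (\<lambda>\<omega>. ?D (X \<omega>)) + C \<ge> 0" using ED A C by simp
    from nn nn_integral_eq_integral[OF Nint] ennreal_le_iff[OF this] show ?thesis by simp
  qed
  have GH: "square_integrable M (\<lambda>\<omega>. G \<omega> - hs)"
    using Nint by (simp add: square_integrable_def)
  thus G2: "square_integrable M G"
    by (simp add: square_integrable_diff_const_iff finite_measure_axioms)
  let ?g = "\<lambda>\<omega>. grad f (X \<omega>)"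
  \<comment> \<open>The other factor of the cross term is a function of \<open>X\<close>, which is
    why conditioning on \<open>X\<close> alone is enough.\<close>
  have ZF: "?Z \<in> borel_measurable ?F" using XF by measurable
  note ce = expectation_inner_vec_cond_exp[OF F ZF Z G2]
  have ae: "AE \<omega> in M. ?Z \<omega> \<bullet> vec_cond_exp M ?F G \<omega> = ?Z \<omega> \<bullet> ?g \<omega>"
    using unbiased by auto
  have zg_int: "integrable M (\<lambda>\<omega>. ?Z \<omega> \<bullet> ?g \<omega>)"
    by (rule integrable_cong_AE_imp[OF ce(1)]) (use ae in \<open>auto elim: AE_mp\<close>)
  have zg: "expectation (\<lambda>\<omega>. ?Z \<omega> \<bullet> G \<omega>) = expectation (\<lambda>\<omega>. ?Z \<omega> \<bullet> ?g \<omega>)"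
    unfolding ce(2)[symmetric]
    by (rule integral_cong_AE) (use ae borel_measurable_integrable[OF ce(1)] in auto)
  have zh_int: "integrable M (\<lambda>\<omega>. ?Z \<omega> \<bullet> hs)"
    by (intro square_integrable_inner[OF Z] square_integrable_const)
  have cross: "expectation (\<lambda>\<omega>. ?Z \<omega> \<bullet> (G \<omega> - hs)) = expectation (\<lambda>\<omega>. ?Z \<omega> \<bullet> (?g \<omega> - hs))"
    using zg zg_int zh_int square_integrable_inner[OF Z G2]
    by (simp add: inner_diff_right)
  have "expectation (\<lambda>\<omega>. ?D (X \<omega>)) + \<mu> / 2 * expectation (\<lambda>\<omega>. (norm (?Z \<omega>))\<^sup>2)
      = expectation (\<lambda>\<omega>. ?D (X \<omega>) + \<mu> / 2 * (norm (?Z \<omega>))\<^sup>2)"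
    using Dint square_integrable_norm2[OF Z] by simp
  also have "\<dots> \<le> expectation (\<lambda>\<omega>. ?Z \<omega> \<bullet> (?g \<omega> - hs))"
  proof (rule integral_mono)
    show "integrable M (\<lambda>\<omega>. ?D (X \<omega>) + \<mu> / 2 * (norm (?Z \<omega>))\<^sup>2)"
      using Dint square_integrable_norm2[OF Z] by simp
    show "integrable M (\<lambda>\<omega>. ?Z \<omega> \<bullet> (?g \<omega> - hs))"
      unfolding inner_diff_right using zg_int zh_int by (rule Bochner_Integration.integrable_diff)
  qed (rule lower)
  finally have crossb: "expectation (\<lambda>\<omega>. ?D (X \<omega>)) + \<mu> / 2 * expectation (\<lambda>\<omega>. (norm (?Z \<omega>))\<^sup>2)
      \<le> expectation (\<lambda>\<omega>. ?Z \<omega> \<bullet> (G \<omega> - hs))"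
    by (simp only: cross)
  have expand: "(norm (?Z \<omega> - \<gamma> *\<^sub>R (G \<omega> - hs)))\<^sup>2
      = (norm (?Z \<omega>))\<^sup>2 - 2 * \<gamma> * (?Z \<omega> \<bullet> (G \<omega> - hs)) + \<gamma>\<^sup>2 * ?N \<omega>" for \<omega>
  proof -
    have "(norm (a - \<gamma> *\<^sub>R b))\<^sup>2 = (norm a)\<^sup>2 - 2 * \<gamma> * (a \<bullet> b) + \<gamma>\<^sup>2 * (norm b)\<^sup>2" for a b :: 'a
      unfolding power2_norm_eq_inner inner_simps inner_commute[of b a]
      by (simp add: power2_eq_square algebra_simps)
    thus ?thesis .
  qed
  have "expectation (\<lambda>\<omega>. (norm (?Z \<omega> - \<gamma> *\<^sub>R (G \<omega> - hs)))\<^sup>2)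
      = expectation (\<lambda>\<omega>. (norm (?Z \<omega>))\<^sup>2) - 2 * \<gamma> * expectation (\<lambda>\<omega>. ?Z \<omega> \<bullet> (G \<omega> - hs))
        + \<gamma>\<^sup>2 * expectation ?N"
    unfolding expand
    using square_integrable_norm2[OF Z] square_integrable_inner[OF Z GH] Nint by simp
  also have "\<dots> \<le> expectation (\<lambda>\<omega>. (norm (?Z \<omega>))\<^sup>2)
      - 2 * \<gamma> * (expectation (\<lambda>\<omega>. ?D (X \<omega>)) + \<mu> / 2 * expectation (\<lambda>\<omega>. (norm (?Z \<omega>))\<^sup>2))
      + \<gamma>\<^sup>2 * (2 * A * expectation (\<lambda>\<omega>. ?D (X \<omega>)) + C)"
    using crossb EN \<gamma>(1) by (intro add_mono diff_mono mult_left_mono) auto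
  also have "\<dots> = (1 - \<gamma> * \<mu>) * expectation (\<lambda>\<omega>. (norm (?Z \<omega>))\<^sup>2) + \<gamma>\<^sup>2 * C
      - 2 * \<gamma> * (1 - \<gamma> * A) * expectation (\<lambda>\<omega>. ?D (X \<omega>))"
    by (simp add: algebra_simps power2_eq_square)
  also have "\<dots> \<le> (1 - \<gamma> * \<mu>) * expectation (\<lambda>\<omega>. (norm (?Z \<omega>))\<^sup>2) + \<gamma>\<^sup>2 * C"
    using \<gamma> ED by simp
  finally show "expectation (\<lambda>\<omega>. (norm (?Z \<omega> - \<gamma> *\<^sub>R (G \<omega> - hs)))\<^sup>2)
      \<le> (1 - \<gamma> * \<mu>) * expectation (\<lambda>\<omega>. (norm (?Z \<omega>))\<^sup>2) + \<gamma>\<^sup>2 * C" .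
qed

section \<open>The sigma-algebra of everything drawn before a coin flip\<close>

text \<open>The ranges differ because the gradient of iteration \<open>t\<close> is drawn before
  coin \<open>t\<close>: gradients count up to and including \<open>t\<close>, coins only below
  it.\<close>

lemma measurable_past:
  fixes g :: "nat \<Rightarrow> 'w \<Rightarrow> 'a::euclidean_space" and \<theta> :: "nat \<Rightarrow> 'w \<Rightarrow> bool"
  assumes g: "\<And>s. g s \<in> borel_measurable M"
    and \<theta>: "\<And>s. \<theta> s \<in> measurable M (count_space UNIV)"
    and F: "F = sigma_of M (PiM {..t} (\<lambda>_. borel) \<Otimes>\<^sub>M PiM {..<t} (\<lambda>_. count_space UNIV))
          (\<lambda>\<omega>. (\<lambda>s\<in>{..t}. g s \<omega>, \<lambda>s\<in>{..<t}. \<theta> s \<omega>))"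
  shows "subalgebra M F"
    and "s \<le> t \<Longrightarrow> g s \<in> borel_measurable F"
    and "s < t \<Longrightarrow> \<theta> s \<in> measurable F (count_space UNIV)"
proof -
  let ?P = "PiM {..t} (\<lambda>_. borel :: 'a measure)" and ?Q = "PiM {..<t} (\<lambda>_. count_space (UNIV :: bool set))"
  let ?H = "\<lambda>\<omega>. (\<lambda>s\<in>{..t}. g s \<omega>, \<lambda>s\<in>{..<t}. \<theta> s \<omega>)"
  have H: "?H \<in> measurable M (?P \<Otimes>\<^sub>M ?Q)"
    using g \<theta> by (intro measurable_Pair measurable_restrict) auto
  show "subalgebra M F" unfolding F by (rule subalgebra_sigma_of[OF H])
  have HF: "?H \<in> measurable F (?P \<Otimes>\<^sub>M ?Q)" unfolding F by (rule measurable_sigma_of[OF H])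
  show "g s \<in> borel_measurable F" if "s \<le> t"
  proof -
    have "(\<lambda>z. fst z s) \<in> measurable (?P \<Otimes>\<^sub>M ?Q) borel"
      using that by (intro measurable_compose[OF measurable_fst measurable_component_singleton]) auto
    from measurable_compose[OF HF this] show ?thesis using that by simp
  qed
  show "\<theta> s \<in> measurable F (count_space UNIV)" if "s < t"
  proof -
    have "(\<lambda>z. snd z s) \<in> measurable (?P \<Otimes>\<^sub>M ?Q) (count_space UNIV)"
      using that by (intro measurable_compose[OF measurable_snd measurable_component_singleton]) auto
    from measurable_compose[OF HF this] show ?thesis using that by simp
  qed
qed

section \<open>Convergence of the iterates, by induction on the iteration\<close>

theorem theorem5p5:
  fixes f :: "'a::euclidean_space \<Rightarrow> real"
    and \<psi> :: "'a \<Rightarrow> ereal"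
    and L \<mu> \<gamma> p A C :: real
    and xstar hstar x0 h0 :: 'a
    and M :: "'w measure"
    and g :: "nat \<Rightarrow> 'w \<Rightarrow> 'a"
    and \<theta> :: "nat \<Rightarrow> 'w \<Rightarrow> bool"
    and x h :: "nat \<Rightarrow> 'w \<Rightarrow> 'a"
    and T :: nat
  assumes smooth: "L_smooth L f"
    and strong: "strongly_convex \<mu> f" and mu_pos: "\<mu> > 0"
    and psi: "proper_closed_convex \<psi>"
    and xstar: "is_arg_min (\<lambda>y. ereal (f y) + \<psi> y) (\<lambda>_. True) xstar"
    and hstar: "hstar = grad f xstar"
    and M: "prob_space M"
    and g_rv: "\<And>t. g t \<in> borel_measurable M"
    and theta_rv: "\<And>t. \<theta> t \<in> measurable M (count_space UNIV)"
    and theta_prob: "\<And>t. measure M {\<omega> \<in> space M. \<theta> t \<omega>} = p"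
    and theta_indep: "\<And>t. coin_independent_of_past M g \<theta> t"
    and iterates: "\<And>t \<omega>. \<omega> \<in> space M \<Longrightarrow>
          (x t \<omega>, h t \<omega>) = sproxskip \<psi> \<gamma> p x0 h0 (\<lambda>s. g s \<omega>) (\<lambda>s. \<theta> s \<omega>) t"
    and unbiased: "\<And>t. AE \<omega> in M.
          vec_cond_exp M (sigma_of M borel (x t)) (g t) \<omega> = grad f (x t \<omega>)"
    and A_nonneg: "A \<ge> 0" and C_nonneg: "C \<ge> 0"
    and second_moment: "\<And>t. AE \<omega> in M.
          nn_cond_exp M (sigma_of M borel (x t)) (\<lambda>\<omega>'. ennreal ((norm (g t \<omega>' - grad f xstar))\<^sup>2)) \<omega>
            \<le> ennreal (2 * A * bregman f (x t \<omega>) xstar + C)"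
    \<comment> \<open>division in ereal, so that the bound is \<open>\<infinity>\<close> when \<open>A = 0\<close>\<close>
    and gamma: "0 < \<gamma>" "ereal \<gamma> \<le> 1 / ereal A"
    and p: "0 < p" "p \<le> 1"
    and T: "T \<ge> 1"
  shows "let \<zeta> = min (\<gamma> * \<mu>) (p\<^sup>2);
             \<Psi> = (\<lambda>t \<omega>. (norm (x t \<omega> - xstar))\<^sup>2 + \<gamma>\<^sup>2 / p\<^sup>2 * (norm (h t \<omega> - hstar))\<^sup>2);
             \<Psi>0 = (norm (x0 - xstar))\<^sup>2 + \<gamma>\<^sup>2 / p\<^sup>2 * (norm (h0 - hstar))\<^sup>2
         in integrable M (\<Psi> T) \<and>
            integral\<^sup>L M (\<Psi> T) \<le> (1 - \<zeta>) ^ T * \<Psi>0 + \<gamma>\<^sup>2 * C / \<zeta>"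
proof -
  interpret prob_space M by fact
  define c where "c = \<gamma>\<^sup>2 / p\<^sup>2"
  define \<zeta> where "\<zeta> = min (\<gamma> * \<mu>) (p\<^sup>2)"
  define \<Psi> where "\<Psi> = (\<lambda>t \<omega>. (norm (x t \<omega> - xstar))\<^sup>2 + c * (norm (h t \<omega> - hstar))\<^sup>2)"
  define \<Psi>0 where "\<Psi>0 = (norm (x0 - xstar))\<^sup>2 + c * (norm (h0 - hstar))\<^sup>2"
  have c: "c > 0" using gamma p by (simp add: c_def)
  \<comment> \<open>The bound \<open>\<zeta> \<le> 1\<close> comes from \<open>p \<le> 1\<close>; it
    allows the induction hypothesis to be multiplied by \<open>1 - \<zeta>\<close>.\<close>
  have \<zeta>: "\<zeta> > 0" "\<zeta> \<le> 1" "\<zeta> \<le> \<gamma> * \<mu>" "\<zeta> \<le> p\<^sup>2"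
    using gamma(1) mu_pos p power_le_one[of p 2] by (auto simp: \<zeta>_def min_le_iff_disj)
  \<comment> \<open>For \<open>A = 0\<close> the extended quotient is infinite, but the product form
    of the condition holds trivially.\<close>
  have \<gamma>A: "\<gamma> * A \<le> 1"
  proof (cases "A = 0")
    case False
    hence "\<gamma> \<le> 1 / A" using gamma(2) by (simp add: one_ereal_def)
    thus ?thesis using False A_nonneg by (simp add: field_simps)
  qed simp
  have "GDERIV f xstar :> hstar"
    unfolding hstar using smooth by (intro GDERIV_grad) (auto simp: L_smooth_def)
  \<comment> \<open>Besides expressing optimality, this subgradient supplies the affine minorant
    that guarantees existence of the proximal minimizers.\<close>
  hence sub: "ereal_subgradient \<psi> xstar (- hstar)"
    using ereal_subgradient_of_arg_min[OF psi, of 1 f xstar hstar] xstar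
    by (simp flip: one_ereal_def)
  have "1-lipschitz_on UNIV (prox (\<gamma> / p) \<psi>)"
    using gamma(1) p(1) by (intro prox_nonexpansive[OF psi _ sub]) simp
  hence prox_meas: "prox (\<gamma> / p) \<psi> \<in> borel_measurable borel"
    by (intro borel_measurable_continuous_onI lipschitz_on_continuous_on)
  have xh_meas: "x t \<in> borel_measurable N" "h t \<in> borel_measurable N"
    if "space N = space M" "\<And>s. s < t \<Longrightarrow> g s \<in> borel_measurable N"
      "\<And>s. s < t \<Longrightarrow> \<theta> s \<in> measurable N (count_space UNIV)" for t N
  proof -
    let ?z = "\<lambda>\<omega>. sproxskip \<psi> \<gamma> p x0 h0 (\<lambda>s. g s \<omega>) (\<lambda>s. \<theta> s \<omega>) t"
    have 1: "x t \<omega> = fst (?z \<omega>)" "h t \<omega> = snd (?z \<omega>)" if "\<omega> \<in> space N" for \<omega>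
      using iterates[of \<omega> t] that \<open>space N = space M\<close> by (metis fst_conv snd_conv)+
    have 2: "(\<lambda>\<omega>. fst (?z \<omega>)) \<in> borel_measurable N" "(\<lambda>\<omega>. snd (?z \<omega>)) \<in> borel_measurable N"
      using measurable_sproxskip[OF prox_meas that(2,3)] by auto
    show "x t \<in> borel_measurable N" by (rule measurable_cong[THEN iffD2, OF 1(1) 2(1)])
    show "h t \<in> borel_measurable N" by (rule measurable_cong[THEN iffD2, OF 1(2) 2(2)])
  qed
  note xhM = xh_meas[of M, OF refl g_rv theta_rv]
  \<comment> \<open>Square integrability of both iterates is carried along, since the gradient step
    needs it for \<open>x t\<close> and the bounds for the two coin outcomes need it for
    \<open>h t\<close>.\<close>
  have main: "square_integrable M (x t) \<and> square_integrable M (h t) \<and> integrable M (\<Psi> t) \<and>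
      expectation (\<Psi> t) \<le> (1 - \<zeta>) ^ t * \<Psi>0 + \<gamma>\<^sup>2 * C / \<zeta>" for t
  proof (induction t)
    case 0
    have x: "x 0 \<omega> = x0" and h: "h 0 \<omega> = h0" if "\<omega> \<in> space M" for \<omega>
      using iterates[OF that, of 0] by auto
    have "square_integrable M (x 0)"
      by (rule square_integrable_bound[OF xhM(1) integrable_const[of "(norm x0)\<^sup>2"]]) (simp add: x)
    moreover have "square_integrable M (h 0)"
      by (rule square_integrable_bound[OF xhM(2) integrable_const[of "(norm h0)\<^sup>2"]]) (simp add: h)
    moreover have 1: "\<Psi> 0 \<omega> = \<Psi>0" if "\<omega> \<in> space M" for \<omega>
      using that by (simp add: \<Psi>_def \<Psi>0_def x h)
    hence "integrable M (\<Psi> 0) \<longleftrightarrow> integrable M (\<lambda>_. \<Psi>0)"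
      by (intro Bochner_Integration.integrable_cong) auto
    hence "integrable M (\<Psi> 0)" by simp
    moreover have "expectation (\<Psi> 0) = expectation (\<lambda>_. \<Psi>0)"
      using 1 by (intro Bochner_Integration.integral_cong) auto
    hence "expectation (\<Psi> 0) = \<Psi>0" by (simp add: prob_space)
    ultimately show ?case using \<zeta> C_nonneg by simp
  next
    case (Suc t)
    hence x2: "square_integrable M (x t)" and h2: "square_integrable M (h t)"
      and IH: "expectation (\<Psi> t) \<le> (1 - \<zeta>) ^ t * \<Psi>0 + \<gamma>\<^sup>2 * C / \<zeta>"
      by auto
    note step = expected_gradient_step[OF M smooth strong mu_pos hstar x2 g_rv unbiased
        A_nonneg C_nonneg second_moment[folded hstar] gamma(1) \<gamma>A]
    define d where "d = (\<lambda>\<omega>. (x t \<omega> - xstar) - \<gamma> *\<^sub>R (g t \<omega> - hstar))"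
    define e where "e = (\<lambda>\<omega>. h t \<omega> - hstar)"
    \<comment> \<open>\<open>Y1\<close> and \<open>Y0\<close> are the pathwise bounds for the coin
      values 1 and 0. Neither involves coin \<open>t\<close>, so both are measurable with respect to
      the past \<open>F\<close>.\<close>
    define Y1 where "Y1 = (\<lambda>\<omega>. (norm (d \<omega> + (\<gamma> - \<gamma> / p) *\<^sub>R e \<omega>))\<^sup>2)"
    define Y0 where "Y0 = (\<lambda>\<omega>. (norm (d \<omega> + \<gamma> *\<^sub>R e \<omega>))\<^sup>2 + c * (norm (e \<omega>))\<^sup>2)"
    have fm: "finite_measure M" by (rule finite_measure_axioms)
    have x2': "square_integrable M (\<lambda>\<omega>. x t \<omega> - xstar)"
      using x2 by (simp add: square_integrable_diff_const_iff[OF fm])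
    have d2: "square_integrable M d"
      unfolding d_def using step(1)
      by (intro square_integrable_diff[OF x2'] square_integrable_scaleR)
        (simp add: square_integrable_diff_const_iff[OF fm])
    have e2: "square_integrable M e"
      unfolding e_def using h2 by (simp add: square_integrable_diff_const_iff[OF fm])
    have Y1int: "integrable M Y1"
      unfolding Y1_def
      by (intro square_integrable_norm2 square_integrable_add[OF d2] square_integrable_scaleR e2)
    have Y0int: "integrable M Y0"
      unfolding Y0_def
      by (intro Bochner_Integration.integrable_add integrable_mult_right square_integrable_norm2
          square_integrable_add[OF d2] square_integrable_scaleR e2)
    define F where "F = sigma_of M (PiM {..t} (\<lambda>_. borel) \<Otimes>\<^sub>M PiM {..<t} (\<lambda>_. count_space UNIV))
          (\<lambda>\<omega>. (\<lambda>s\<in>{..t}. g s \<omega>, \<lambda>s\<in>{..<t}. \<theta> s \<omega>))"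
    note past = measurable_past[where g = g and \<theta> = \<theta>, OF g_rv theta_rv F_def]
    have [measurable]: "x t \<in> borel_measurable F" "h t \<in> borel_measurable F"
      "g t \<in> borel_measurable F"
      by (intro xh_meas past; simp add: F_def)+
    have Y1F: "Y1 \<in> borel_measurable F" and Y0F: "Y0 \<in> borel_measurable F"
      unfolding Y1_def Y0_def d_def e_def by measurable
    have indep: "indep_set (sets (sigma_of M (count_space UNIV) (\<theta> t))) (sets F)"
      using theta_indep[of t] by (simp add: coin_independent_of_past_def F_def)
    note coin = expectation_if_indep[OF past(1) theta_rv indep Y1F Y1int Y0F Y0int,
        unfolded theta_prob]
    have bound: "\<Psi> (Suc t) \<omega> \<le> (if \<theta> t \<omega> then Y1 \<omega> else Y0 \<omega>)" if "\<omega> \<in> space M" for \<omega>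
    proof -
      have "(x (Suc t) \<omega>, h (Suc t) \<omega>)
          = sproxskip_step \<psi> \<gamma> p (g t \<omega>) (\<theta> t \<omega>) (x t \<omega>, h t \<omega>)"
        using iterates[OF that, of t] iterates[OF that, of "Suc t"] by simp
      from sproxskip_step_bound[OF psi gamma(1) p(1) sub this refl refl]
      show ?thesis by (simp only: \<Psi>_def Y1_def Y0_def d_def e_def c_def)
    qed
    \<comment> \<open>\<Psi> dominates both squared distances up to a constant factor, so
      integrability of \<open>\<Psi> (Suc t)\<close> returns square integrability of the next
      iterates.\<close>
    have \<Psi>ge: "0 \<le> \<Psi> s \<omega>" "(norm (x s \<omega> - xstar))\<^sup>2 \<le> \<Psi> s \<omega>"
      "(norm (h s \<omega> - hstar))\<^sup>2 \<le> 1 / c * \<Psi> s \<omega>" for s \<omega>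
      using c by (auto simp: \<Psi>_def field_simps)
    have [measurable]: "x (Suc t) \<in> borel_measurable M" "h (Suc t) \<in> borel_measurable M"
      by (rule xhM)+
    have \<Psi>int: "integrable M (\<Psi> (Suc t))"
    proof (rule Bochner_Integration.integrable_bound[OF coin(1)])
      show "\<Psi> (Suc t) \<in> borel_measurable M" unfolding \<Psi>_def by measurable
      show "AE \<omega> in M. norm (\<Psi> (Suc t) \<omega>) \<le> norm (if \<theta> t \<omega> then Y1 \<omega> else Y0 \<omega>)"
        using bound \<Psi>ge(1)[of "Suc t"] by (intro AE_I2) (force intro: order_trans[OF _ abs_ge_self])
    qed
    have "square_integrable M (\<lambda>\<omega>. x (Suc t) \<omega> - xstar)"
      by (rule square_integrable_bound[OF _ \<Psi>int]) (use \<Psi>ge in auto)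
    moreover have "square_integrable M (\<lambda>\<omega>. h (Suc t) \<omega> - hstar)"
      by (rule square_integrable_bound[OF _ integrable_mult_right[OF \<Psi>int, of "1 / c"]])
        (use \<Psi>ge(3) in auto)
    moreover have "expectation (\<Psi> (Suc t)) \<le> (1 - \<zeta>) ^ Suc t * \<Psi>0 + \<gamma>\<^sup>2 * C / \<zeta>"
    proof -
      note xi = square_integrable_norm2[OF x2'] and di = square_integrable_norm2[OF d2]
        and ei = square_integrable_norm2[OF e2]
      let ?X = "expectation (\<lambda>\<omega>. (norm (x t \<omega> - xstar))\<^sup>2)"
      let ?E = "expectation (\<lambda>\<omega>. (norm (e \<omega>))\<^sup>2)"
      have "expectation (\<Psi> (Suc t)) \<le> expectation (\<lambda>\<omega>. if \<theta> t \<omega> then Y1 \<omega> else Y0 \<omega>)"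
        using bound by (intro integral_mono \<Psi>int coin(1)) auto
      also have "\<dots> = p * expectation Y1 + (1 - p) * expectation Y0" by (rule coin(2))
      also have "\<dots> = expectation (\<lambda>\<omega>. p * Y1 \<omega> + (1 - p) * Y0 \<omega>)"
        using Y1int Y0int by simp
      also have "(\<lambda>\<omega>. p * Y1 \<omega> + (1 - p) * Y0 \<omega>)
          = (\<lambda>\<omega>. (norm (d \<omega>))\<^sup>2 + (1 - p\<^sup>2) * (c * (norm (e \<omega>))\<^sup>2))"
        unfolding Y1_def Y0_def c_def using p(1) by (intro ext coin_average_identity) simp
      also have "expectation \<dots> = expectation (\<lambda>\<omega>. (norm (d \<omega>))\<^sup>2) + (1 - p\<^sup>2) * (c * ?E)"
        using di ei by simp
      also have "\<dots> \<le> ((1 - \<gamma> * \<mu>) * ?X + \<gamma>\<^sup>2 * C) + (1 - p\<^sup>2) * (c * ?E)"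
        using step(2) by (simp add: d_def)
      \<comment> \<open>Both contraction factors are weakened to the common
        \<open>1 - \<zeta>\<close>, so that the two expectations recombine into that of
        \<open>\<Psi> t\<close>.\<close>
      also have "\<dots> \<le> ((1 - \<zeta>) * ?X + \<gamma>\<^sup>2 * C) + (1 - \<zeta>) * (c * ?E)"
        using \<zeta> c C_nonneg by (intro add_mono mult_right_mono) auto
      also have "\<dots> = (1 - \<zeta>) * (?X + c * ?E) + \<gamma>\<^sup>2 * C"
        by (simp add: algebra_simps)
      also have "?X + c * ?E = expectation (\<Psi> t)"
        using xi ei by (simp add: \<Psi>_def e_def)
      also have "(1 - \<zeta>) * expectation (\<Psi> t) + \<gamma>\<^sup>2 * C
          \<le> (1 - \<zeta>) * ((1 - \<zeta>) ^ t * \<Psi>0 + \<gamma>\<^sup>2 * C / \<zeta>) + \<gamma>\<^sup>2 * C"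
        using IH \<zeta> by (intro add_mono mult_left_mono) auto
      \<comment> \<open>The noise level \<open>\<gamma>\<^sup>2 * C / \<zeta>\<close> is the fixed
        point of the map sending \<open>a\<close> to
        \<open>(1 - \<zeta>) * a + \<gamma>\<^sup>2 * C\<close>, so it reproduces itself.\<close>
      also have "\<dots> = (1 - \<zeta>) ^ Suc t * \<Psi>0 + \<gamma>\<^sup>2 * C / \<zeta>"
        using \<zeta>(1) by (simp add: field_simps)
      finally show ?thesis .
    qed
    ultimately show ?case using \<Psi>int by (simp add: square_integrable_diff_const_iff[OF fm])
  qed
  show ?thesis
    using main[of T] unfolding Let_def \<zeta>_def \<Psi>_def \<Psi>0_def c_def by blast
qed

end
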